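(* Let $n,d\ge1$ be integers and let $\lambda$ be an integer partition with $|\lambda|\le(n-1)d$ and at most $n-1$ parts. The coefficient $c^{n,d}_\lambda$ is the number of partial maps $g$ from $[n]\times[d]$ to $[n]$ such that $g(i,j)<i$ for all $(i,j)\in\operatorname{Dom}(g)$ and such that the cardinalities of the (nonempty) fibers of $g$ are, as a multiset, the parts of $\lambda$.
   Context: $[n]=\{1,\ldots,n\}$. A partial map $g$ from a set $X$ to a set $Y$ is a map from a subset $\operatorname{Dom}(g)\subseteq X$ to $Y$. For a partition $\lambda=(\lambda_1\ge\cdots\ge\lambda_\ell>0)$, $|\lambda|$ is the sum of its parts, $\lambda\vdash k$ means $|\lambda|=k$, and $\ell(\lambda)=\ell$ is its number of parts; $y_\lambda=\prod_{i=1}^{\ell}y_{\lambda_i}$, with $y_\emptyset=1$. Let $R=\mathbb{Z}[y_i;\ i\geq 0]$ be the commutative polynomial ring, and let $R\langle t\rangle$ be the unital ring generated over $\mathbb{Z}$ by $t$ and the $y_i$, subject only to $y_iy_j=y_jy_i$ for all $i,j\ge0$ (so $t$ does not commute with the $y_i$). Let $\Delta$ be the derivation of $R\langle t\rangle$ (additive, satisfying the Leibniz rule) with $\Delta(y_i)=y_{i+1}$ for all $i\ge0$ and $\Delta(t)=0$, and let $\rho_t$ be right multiplication by $t$. Define $U_{0,d}=1$ and $U_{n+1,d}=y_0(\Delta+\rho_t)^dU_{n,d}$ for $n\ge0$. For $n,d\ge1$ the integers $c^{n,d}_\lambda$ are the coefficients in $$U_{n,d}=\sum_{k=d}^{nd}\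 \sum_{\substack{\lambda\vdash nd-k\\ \ell(\lambda)\le n-1}}c^{n,d}_\lambda\,y_0^{\,n-\ell(\lambda)}y_\lambda t^k.$$ *)

theory Defs
  imports "HOL-Library.Poly_Mapping" "HOL-Library.Multiset"
begin

section \<open>The ring generated by \<open>t\<close> and commuting \<open>y\<^sub>0, y\<^sub>1, \<dots>\<close>\<close>

text \<open>
  The only relations \<open>y\<^sub>i y\<^sub>j = y\<^sub>j y\<^sub>i\<close> are between words in the generators, so the ring they present
  over \<open>\<int>\<close> is the integral monoid ring of the monoid with the same presentation. The monoid is
  written additively, although it is not commutative, because \<open>poly_mapping\<close> takes its monoid
  ring multiplication from the class \<open>monoid_add\<close>.
\<close>

datatype gen = T | Y nat

inductive swap :: "gen list \<Rightarrow> gen list \<Rightarrow> bool" where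
  "swap (u @ [Y i, Y j] @ v) (u @ [Y j, Y i] @ v)"

quotient_type yt_word = "gen list" / "equivclp swap"
  by (rule equivp_evquivclp)

lemma swap_append_left: "swap u v \<Longrightarrow> swap (w @ u) (w @ v)"
proof (induction rule: swap.induct)
  case (1 u i j v)
  show ?case using swap.intros[of "w @ u" i j v] by simp
qed

lemma swap_append_right: "swap u v \<Longrightarrow> swap (u @ w) (v @ w)"
proof (induction rule: swap.induct)
  case (1 u i j v)
  show ?case using swap.intros[of u i j "v @ w"] by simp
qed

lemma equivclp_swap_map:
  assumes "\<And>u v. swap u v \<Longrightarrow> swap (f u) (f v)" and "equivclp swap u v"
  shows "equivclp swap (f u) (f v)"
  using assms(2)
proof (induction rule: equivclp_induct)
  case (step v w)
  then have "swap (f v) (f w) \<or> swap (f w) (f v)"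
    using assms(1) by blast
  with step.IH show ?case
    by (rule equivclp_into_equivclp)
qed simp

instantiation yt_word :: monoid_add
begin

lift_definition zero_yt_word :: yt_word is "[]" .

lift_definition plus_yt_word :: "yt_word \<Rightarrow> yt_word \<Rightarrow> yt_word" is "(@)"
proof -
  fix u u' v v' assume u: "equivclp swap u u'" and v: "equivclp swap v v'"
  have "equivclp swap (u @ v) (u' @ v)"
    by (rule equivclp_swap_map[where f = "\<lambda>x. x @ v", OF _ u]) (rule swap_append_right)
  also have "equivclp swap (u' @ v) (u' @ v')"
    by (rule equivclp_swap_map[OF _ v]) (rule swap_append_left)
  finally (equivclp_trans) show "equivclp swap (u @ v) (u' @ v')" .
qed

instance
  by standard (transfer; simp)+

end

lemma yt_word_cases: obtains l where "w = abs_yt_word l"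
  by (induction w rule: yt_word.abs_induct) auto

type_synonym yt_ring = "yt_word \<Rightarrow>\<^sub>0 int"

definition ring_t :: yt_ring where
  "ring_t = Poly_Mapping.single (abs_yt_word [T]) 1"

definition ring_y :: "nat \<Rightarrow> yt_ring" where
  "ring_y i = Poly_Mapping.single (abs_yt_word [Y i]) 1"

fun gen_val :: "gen \<Rightarrow> yt_ring" where
  "gen_val T = ring_t"
| "gen_val (Y i) = ring_y i"

lemma single_word: "Poly_Mapping.single (abs_yt_word w) 1 = prod_list (map gen_val w)"
proof (induction w)
  case Nil
  then show ?case by (simp flip: zero_yt_word.abs_eq)
next
  case (Cons a w)
  have "gen_val a = Poly_Mapping.single (abs_yt_word [a]) 1"
    by (cases a) (auto simp: ring_t_def ring_y_def)
  moreover have "abs_yt_word (a # w) = abs_yt_word [a] + abs_yt_word w"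
    by (simp add: plus_yt_word.abs_eq)
  ultimately show ?case
    by (simp add: mult_single flip: Cons)
qed

lemma ring_y_commute: "ring_y i * ring_y j = ring_y j * ring_y i"
proof -
  have "equivclp swap [Y i, Y j] [Y j, Y i]"
    using swap.intros[of "[]" i j "[]"] by auto
  then have "abs_yt_word [Y i, Y j] = abs_yt_word [Y j, Y i]"
    by (simp add: yt_word.abs_eq_iff)
  then show ?thesis
    by (simp add: ring_y_def mult_single plus_yt_word.abs_eq)
qed

section \<open>The derivation\<close>

definition is_derivation :: "('a::ring \<Rightarrow> 'a) \<Rightarrow> bool" where
  "is_derivation D \<longleftrightarrow> (\<forall>a b. D (a + b) = D a + D b) \<and> (\<forall>a b. D (a * b) = D a * b + a * D b)"

definition Delta :: "yt_ring \<Rightarrow> yt_ring" where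
  "Delta = (THE D. is_derivation D \<and> (\<forall>i. D (ring_y i) = ring_y (Suc i)) \<and> D ring_t = 0)"

fun gen_deriv :: "gen \<Rightarrow> yt_ring" where
  "gen_deriv T = 0"
| "gen_deriv (Y i) = ring_y (Suc i)"

fun list_deriv :: "gen list \<Rightarrow> yt_ring" where
  "list_deriv [] = 0"
| "list_deriv (a # w) = gen_deriv a * prod_list (map gen_val w) + gen_val a * list_deriv w"

lemma list_deriv_append:
  "list_deriv (u @ v) = list_deriv u * prod_list (map gen_val v) + prod_list (map gen_val u) * list_deriv v"
  by (induction u) (auto simp: algebra_simps)

lemma list_deriv_swap: "swap u v \<Longrightarrow> list_deriv u = list_deriv v"
proof (induction rule: swap.induct)
  case (1 u i j v)
  have comm: "list_deriv [Y i, Y j] = list_deriv [Y j, Y i]"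
    using ring_y_commute[of i "Suc j"] ring_y_commute[of j "Suc i"] by simp
  have "prod_list (map gen_val [Y i, Y j]) = prod_list (map gen_val [Y j, Y i])"
    using ring_y_commute[of i j] by simp
  with comm show ?case
    by (simp only: list_deriv_append map_append prod_list.append)
qed

lift_definition word_deriv :: "yt_word \<Rightarrow> yt_ring" is list_deriv
proof -
  fix u v assume "equivclp swap u v"
  then show "list_deriv u = list_deriv v"
    by (induction rule: equivclp_induct) (auto dest: list_deriv_swap)
qed

lemma word_deriv_plus:
  "word_deriv (u + v) = word_deriv u * frag_of v + frag_of u * word_deriv v"
proof -
  obtain a b where "u = abs_yt_word a" "v = abs_yt_word b"
    using yt_word_cases by metis
  then show ?thesis
    by (simp add: plus_yt_word.abs_eq word_deriv.abs_eq list_deriv_append single_word)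
qed

lemma is_derivation_frag_extend: "is_derivation (frag_extend word_deriv)"
proof -
  let ?D = "frag_extend word_deriv"
  have 1: "?D (frag_of u * b) = ?D (frag_of u) * b + frag_of u * ?D b" for u b
    using subset_UNIV[of "Poly_Mapping.keys b"]
  proof (induction b rule: frag_induction)
    case (one v)
    then show ?case by (simp add: mult_single word_deriv_plus)
  qed (auto simp: frag_extend_diff algebra_simps)
  have "?D (a * b) = ?D a * b + a * ?D b" for a b
    using subset_UNIV[of "Poly_Mapping.keys a"]
    by (induction a rule: frag_induction)
       (simp_all add: 1 frag_extend_diff left_diff_distrib algebra_simps del: frag_extend_of)
  then show ?thesis by (simp add: is_derivation_def frag_extend_add)
qed

lemma derivation_diff:
  assumes "is_derivation D" shows "D (a - b) = D a - D b"
proof -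
  have "D a = D (a - b + b)" by simp
  also have "\<dots> = D (a - b) + D b" using assms unfolding is_derivation_def by blast
  finally show ?thesis by (simp add: algebra_simps)
qed

lemma Delta_ex1: "\<exists>!D. is_derivation D \<and> (\<forall>i. D (ring_y i) = ring_y (Suc i)) \<and> D ring_t = 0"
proof (rule ex_ex1I)
  have "frag_extend word_deriv (ring_y i) = ring_y (Suc i)" "frag_extend word_deriv ring_t = 0" for i
    by (simp_all add: ring_y_def ring_t_def word_deriv.abs_eq)
  then show "\<exists>D. is_derivation D \<and> (\<forall>i. D (ring_y i) = ring_y (Suc i)) \<and> D ring_t = 0"
    using is_derivation_frag_extend by blast
next
  fix D E :: "yt_ring \<Rightarrow> yt_ring"
  assume D: "is_derivation D \<and> (\<forall>i. D (ring_y i) = ring_y (Suc i)) \<and> D ring_t = 0"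
    and E: "is_derivation E \<and> (\<forall>i. E (ring_y i) = ring_y (Suc i)) \<and> E ring_t = 0"
  have gen: "D (gen_val a) = E (gen_val a)" for a
    using D E by (cases a) auto
  have one: "F 1 = 0" if "is_derivation F" for F :: "yt_ring \<Rightarrow> yt_ring"
  proof -
    have "F (1 * 1) = F 1 * 1 + 1 * F 1" using that unfolding is_derivation_def by blast
    then show ?thesis by simp
  qed
  have word: "D (frag_of w) = E (frag_of w)" for w
  proof -
    obtain l where l: "w = abs_yt_word l"
      using yt_word_cases by metis
    have "D (prod_list (map gen_val l)) = E (prod_list (map gen_val l))"
    proof (induction l)
      case (Cons a l)
      then show ?case
        using D E gen[of a] by (simp add: is_derivation_def)
    qed (use one[of D] one[of E] D E in simp)
    then show ?thesis by (simp add: l single_word)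
  qed
  show "D = E"
  proof
    fix p show "D p = E p"
      using subset_UNIV[of "Poly_Mapping.keys p"]
    proof (induction p rule: frag_induction)
      case zero
      show ?case using derivation_diff[of D 0 0] derivation_diff[of E 0 0] D E by simp
    qed (auto simp: word derivation_diff[of D] derivation_diff[of E] D E)
  qed
qed

lemma
  shows is_derivation_Delta: "is_derivation Delta"
    and Delta_ring_y: "Delta (ring_y i) = ring_y (Suc i)"
    and Delta_ring_t: "Delta ring_t = 0"
  using theI'[OF Delta_ex1] unfolding Delta_def by blast+

section \<open>The coefficients\<close>

fun U_poly :: "nat \<Rightarrow> nat \<Rightarrow> yt_ring" where
  "U_poly 0 d = 1"
| "U_poly (Suc n) d = ring_y 0 * ((\<lambda>p. Delta p + p * ring_t) ^^ d) (U_poly n d)"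

definition is_partition :: "nat list \<Rightarrow> bool" where
  "is_partition lam \<longleftrightarrow> sorted_wrt (\<ge>) lam \<and> (\<forall>i\<in>set lam. 0 < i)"

definition monom_word :: "nat \<Rightarrow> nat list \<Rightarrow> nat \<Rightarrow> yt_word" where
  "monom_word m lam k = abs_yt_word (replicate m (Y 0) @ map Y lam @ replicate k T)"

lemma single_monom_word:
  "Poly_Mapping.single (monom_word m lam k) 1 = ring_y 0 ^ m * prod_list (map ring_y lam) * ring_t ^ k"
  by (simp add: monom_word_def single_word comp_def mult.assoc)

text \<open>
  The exponent of \<open>t\<close> accompanying \<open>lam\<close> in the expansion of \<open>U_poly n d\<close> is the \<open>k\<close> with \<open>|lam| = nd - k\<close>.
  The subtractions are exact for \<open>lam\<close> with at most \<open>n - 1\<close> parts and \<open>|lam| \<le> (n - 1)d\<close>.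
\<close>

definition coeff_c :: "nat \<Rightarrow> nat \<Rightarrow> nat list \<Rightarrow> int" where
  "coeff_c n d lam = Poly_Mapping.lookup (U_poly n d) (monom_word (n - length lam) lam (n * d - sum_list lam))"

section \<open>Partial maps\<close>

definition partial_maps :: "'a set \<Rightarrow> 'b set \<Rightarrow> ('a \<rightharpoonup> 'b) set" where
  "partial_maps A B = {g. dom g \<subseteq> A \<and> ran g \<subseteq> B}"

text \<open>The nonempty fibres of \<open>g\<close> are those over \<open>ran g\<close>; meaningful only if \<open>ran g\<close> is finite.\<close>

definition fibre_cards :: "('a \<rightharpoonup> 'b) \<Rightarrow> nat multiset" where
  "fibre_cards g = image_mset (\<lambda>b. card {a. g a = Some b}) (mset_set (ran g))"

end

theory Submission
  imports Defs
begin

text \<open>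
  Expand \<open>U_poly n d\<close> completely, keeping its \<open>n\<close> factors \<open>y\<close> apart. Call the factor that is
  prefixed to form \<open>U_poly k d\<close> factor \<open>k\<close>; it starts as \<open>y\<^sub>0\<close>. By the Leibniz rule one
  application of \<open>\<Delta> + \<rho>\<^sub>t\<close> to a product of factors \<open>y\<close> followed by a power of \<open>t\<close> is a sum over
  the possible choices: either raise the index of one of the factors present, or append a \<open>t\<close>. The
  \<open>j\<close>th of the \<open>d\<close> applications that lead to \<open>U_poly i d\<close> is represented by the cell \<open>(i, j)\<close>; at
  that moment the factors present are those numbered \<open>k < i\<close>. A term of the full expansion is thus
  a partial map \<open>g\<close> with \<open>g (i, j) < i\<close>, undefined where \<open>t\<close> was appended, and the final index of
  factor \<open>k\<close> is the size of the fibre of \<open>g\<close> over \<open>k\<close>. This is \<open>U_poly_expansion\<close>, proved cell by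
  cell from \<open>op_term\<close> (what one application does to a term) and \<open>sum_choices_insert\<close> (what one more
  cell does to the set of partial maps).

  It remains to see which terms contribute to a given coefficient. Every term has the form
  \<open>y \<cdots> y t\<^sup>k\<close>, and two such words agree in the monoid exactly if they have the same multiset of
  indices and the same \<open>k\<close> (\<open>abs_normal_word_eq_iff\<close>). The indices of the term of \<open>g\<close> are the
  sizes of all \<open>n\<close> fibres, so they are the nonempty fibre sizes padded with zeros.
\<close>

section \<open>Words with all letters \<open>t\<close> at the end\<close>

text \<open>
  The invariant that tells normal words apart: it determines the number of letters \<open>t\<close> and the
  multiset of indices.
\<close>

lemma equivclp_swap_mset: "equivclp swap u v \<Longrightarrow> mset u = mset v"
proof (induction rule: equivclp_induct)
  case (step v w)
  have "swap a b \<Longrightarrow> mset a = mset b" for a b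
    by (induction rule: swap.induct) simp
  with step show ?case by metis
qed simp

lemma prod_list_ring_y_cong_mset:
  assumes "mset as = mset bs"
  shows "prod_list (map ring_y as) = prod_list (map ring_y bs)"
proof -
  have eq: "prod_list (map ring_y xs) = fold (\<lambda>i p. ring_y i * p) (rev xs) 1" for xs
    by (simp add: prod_list.eq_foldr foldr_conv_fold rev_map fold_map comp_def)
  have "fold (\<lambda>i p. ring_y i * p) (rev as) = fold (\<lambda>i p. ring_y i * p) (rev bs)"
  proof (rule fold_multiset_equiv)
    show "(\<lambda>p. ring_y x * p) \<circ> (\<lambda>p. ring_y y * p) = (\<lambda>p. ring_y y * p) \<circ> (\<lambda>p. ring_y x * p)" for x y
      by (simp add: fun_eq_iff ring_y_commute[of x y] flip: mult.assoc)
  qed (use assms in simp)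
  then show ?thesis by (simp add: eq)
qed

lemma single_normal_word:
  "Poly_Mapping.single (abs_yt_word (map Y as @ replicate k T)) 1 = prod_list (map ring_y as) * ring_t ^ k"
  by (simp add: single_word comp_def)

text \<open>
  That equal indices in a different order give equal words is read off in the ring, where it is the
  commutation of the \<open>y\<^sub>i\<close>: distinct monoid elements are distinct basis vectors of the monoid ring.
\<close>

lemma abs_normal_word_eq_iff:
  "abs_yt_word (map Y as @ replicate k T) = abs_yt_word (map Y bs @ replicate l T)
     \<longleftrightarrow> mset as = mset bs \<and> k = l" (is "?L \<longleftrightarrow> ?R")
proof
  assume ?L
  then have eq: "mset (map Y as @ replicate k T) = mset (map Y bs @ replicate l T)"
    by (intro equivclp_swap_mset) (simp add: yt_word.abs_eq_iff)
  have T: "count (image_mset Y M) T = 0" for M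
    by (induction M) auto
  have "count (mset (map Y as @ replicate k T)) T = count (mset (map Y bs @ replicate l T)) T"
    by (simp only: eq)
  then have "k = l" by (simp add: T)
  moreover from this eq have "image_mset Y (mset as) = image_mset Y (mset bs)"
    by simp
  then have "mset as = mset bs"
    by (rule multiset.inj_map_strong[rotated]) simp
  ultimately show ?R by simp
next
  assume ?R
  then have "Poly_Mapping.single (abs_yt_word (map Y as @ replicate k T)) (1 :: int)
      = Poly_Mapping.single (abs_yt_word (map Y bs @ replicate l T)) 1"
    unfolding single_normal_word using prod_list_ring_y_cong_mset by metis
  then show ?L
    by (metis lookup_single_eq lookup_single_not_eq zero_neq_one)
qed

section \<open>Partial maps with prescribed possible values\<close>

definition choices :: "('a \<Rightarrow> 'b set) \<Rightarrow> 'a set \<Rightarrow> ('a \<rightharpoonup> 'b) set" where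
  "choices S A = {g. dom g \<subseteq> A \<and> (\<forall>a b. g a = Some b \<longrightarrow> b \<in> S a)}"

lemma choices_outside: "g \<in> choices S A \<Longrightarrow> a \<notin> A \<Longrightarrow> g a = None"
  by (auto simp: choices_def dom_def)

text \<open>One more cell is one more independent choice: undefined, or any value in \<open>S c\<close>.\<close>

lemma bij_betw_choices_insert:
  assumes "c \<notin> A"
  shows "bij_betw (\<lambda>(g, x). g(c := x)) (choices S A \<times> insert None (Some ` S c)) (choices S (insert c A))"
proof (rule bij_betw_byWitness[where f' = "\<lambda>g. (g(c := None), g c)"])
  show "\<forall>p \<in> choices S A \<times> insert None (Some ` S c).
      (\<lambda>g. (g(c := None), g c)) ((\<lambda>(g, x). g(c := x)) p) = p"
    using choices_outside[OF _ assms, of _ S] by (auto simp: fun_upd_idem)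
  show "(\<lambda>(g, x). g(c := x)) ` (choices S A \<times> insert None (Some ` S c)) \<subseteq> choices S (insert c A)"
    by (fastforce simp: choices_def split: if_splits)
  show "(\<lambda>g. (g(c := None), g c)) ` choices S (insert c A) \<subseteq> choices S A \<times> insert None (Some ` S c)"
  proof (rule image_subsetI)
    fix g assume "g \<in> choices S (insert c A)"
    then show "(g(c := None), g c) \<in> choices S A \<times> insert None (Some ` S c)"
      by (cases "g c") (auto simp: choices_def split: if_splits)
  qed
qed simp

lemma finite_choices:
  assumes "finite A" and "\<And>a. finite (S a)"
  shows "finite (choices S A)"
  using assms(1)
proof (induction A rule: finite_induct)
  case empty
  have "choices S {} = {Map.empty}" by (auto simp: choices_def)
  then show ?case by simp
next
  case (insert c A)
  then show ?case
    using bij_betw_finite[OF bij_betw_choices_insert[OF insert.hyps(2), of S]] assms(2) by simp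
qed

lemma sum_choices_insert:
  fixes f :: "('a \<rightharpoonup> 'b) \<Rightarrow> 'c :: comm_monoid_add"
  assumes "finite A" and "c \<notin> A" and "\<And>a. finite (S a)"
  shows "sum f (choices S (insert c A)) = (\<Sum>g\<in>choices S A. f g + (\<Sum>b\<in>S c. f (g(c \<mapsto> b))))"
proof -
  have "sum f (choices S (insert c A)) = (\<Sum>(g, x)\<in>choices S A \<times> insert None (Some ` S c). f (g(c := x)))"
    using sum.reindex_bij_betw[OF bij_betw_choices_insert[OF assms(2)], where g = f]
    by (simp add: case_prod_unfold)
  also have "\<dots> = (\<Sum>g\<in>choices S A. \<Sum>x\<in>insert None (Some ` S c). f (g(c := x)))"
    by (simp add: sum.cartesian_product)
  also have "\<dots> = (\<Sum>g\<in>choices S A. f g + (\<Sum>b\<in>S c. f (g(c \<mapsto> b))))"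
  proof (rule sum.cong)
    fix g assume "g \<in> choices S A"
    then have "g(c := None) = g"
      using choices_outside[OF _ assms(2)] by (metis fun_upd_triv)
    then show "(\<Sum>x\<in>insert None (Some ` S c). f (g(c := x))) = f g + (\<Sum>b\<in>S c. f (g(c \<mapsto> b)))"
      using assms(3)[of c] by (simp add: sum.insert sum.reindex image_iff)
  qed simp
  finally show ?thesis .
qed

section \<open>The expansion of \<open>U\<close>\<close>

definition fibre_size :: "('a \<rightharpoonup> 'b) \<Rightarrow> 'b \<Rightarrow> nat" where
  "fibre_size g b = card {a. g a = Some b}"

lemma fibre_size_upd:
  assumes "finite (dom g)" and "g c = None"
  shows "fibre_size (g(c \<mapsto> k)) = (fibre_size g)(k := Suc (fibre_size g k))"
proof
  fix b
  have "finite {a. g a = Some b}"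
    using assms(1) by (rule finite_subset[rotated]) auto
  moreover have "{a. (g(c \<mapsto> k)) a = Some b} = (if b = k then insert c else id) {a. g a = Some b}"
    using assms(2) by auto
  ultimately show "fibre_size (g(c \<mapsto> k)) b = ((fibre_size g)(k := Suc (fibre_size g k))) b"
    using assms(2) by (auto simp: fibre_size_def card_insert_if)
qed

abbreviation op :: "yt_ring \<Rightarrow> yt_ring" where
  "op p \<equiv> Delta p + p * ring_t"

lemma Delta_add: "Delta (p + q) = Delta p + Delta q"
  and Delta_mult: "Delta (p * q) = Delta p * q + p * Delta q"
  using is_derivation_Delta unfolding is_derivation_def by blast+

lemma Delta_0: "Delta 0 = 0"
  using Delta_add[of 0 0] by simp

lemma Delta_1: "Delta 1 = 0"
  using Delta_mult[of 1 1] by simp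

lemma Delta_sum: "Delta (sum f A) = (\<Sum>a\<in>A. Delta (f a))"
  by (induction A rule: infinite_finite_induct) (auto simp: Delta_0 Delta_add)

lemma Delta_ring_t_power: "Delta (ring_t ^ k) = 0"
  by (induction k) (auto simp: Delta_1 Delta_mult Delta_ring_t)

text \<open>
  The Leibniz rule for factors \<open>y\<close> labelled by the entries of \<open>xs\<close>. Labels must be distinct, since
  the updated index function has to change one factor only.
\<close>

lemma Delta_prod_list_ring_y:
  assumes "distinct xs"
  shows "Delta (prod_list (map (\<lambda>k. ring_y (a k)) xs))
    = (\<Sum>k\<in>set xs. prod_list (map (\<lambda>l. ring_y ((a(k := Suc (a k))) l)) xs))"
  using assms
proof (induction xs)
  case (Cons x xs)
  let ?P = "\<lambda>k xs. prod_list (map (\<lambda>l. ring_y ((a(k := Suc (a k))) l)) xs)"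
  have "map (\<lambda>l. ring_y ((a(x := Suc (a x))) l)) xs = map (\<lambda>l. ring_y (a l)) xs"
    using Cons.prems by auto
  then have 1: "?P x (x # xs) = ring_y (Suc (a x)) * prod_list (map (\<lambda>l. ring_y (a l)) xs)"
    by (simp only: list.map prod_list.Cons fun_upd_same)
  have 2: "?P k (x # xs) = ring_y (a x) * ?P k xs" if "k \<in> set xs" for k
    using that Cons.prems by auto
  have "Delta (prod_list (map (\<lambda>k. ring_y (a k)) (x # xs)))
      = ?P x (x # xs) + ring_y (a x) * (\<Sum>k\<in>set xs. ?P k xs)"
    unfolding 1 using Cons by (simp add: Delta_mult Delta_ring_y)
  also have "\<dots> = ?P x (x # xs) + (\<Sum>k\<in>set xs. ?P k (x # xs))"
    unfolding sum_distrib_left using 2 by (metis (no_types, lifting) sum.cong)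
  finally show ?case
    using Cons.prems by (simp only: list.set distinct.simps sum.insert finite_set simp_thms)
qed (simp add: Delta_1)

text \<open>
  The term of \<open>g\<close> when \<open>n\<close> factors are present and the cells in \<open>A\<close> have been used. The factors are
  listed by decreasing number because a new factor is multiplied from the left.
\<close>

definition expansion_term :: "nat \<Rightarrow> 'a set \<Rightarrow> ('a \<rightharpoonup> nat) \<Rightarrow> yt_ring" where
  "expansion_term n A g = prod_list (map (\<lambda>k. ring_y (fibre_size g k)) (rev [1..<Suc n])) * ring_t ^ card (A - dom g)"

text \<open>The new cell \<open>c\<close> is left undefined if \<open>\<rho>\<^sub>t\<close> acts, and sent to \<open>k\<close> if \<open>\<Delta>\<close> hits factor \<open>k\<close>.\<close>

lemma op_term:
  assumes "finite A" and "c \<notin> A" and "dom g \<subseteq> A"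
  shows "op (expansion_term n A g) = expansion_term n (insert c A) g
    + (\<Sum>k\<in>{1..<Suc n}. expansion_term n (insert c A) (g(c \<mapsto> k)))"
proof -
  have c: "g c = None" and fin: "finite (dom g)"
    using assms finite_subset by (auto simp: dom_def)
  have "insert c A - dom g = insert c (A - dom g)"
    using assms by auto
  then have t: "card (insert c A - dom g) = Suc (card (A - dom g))"
    using assms by simp
  have u: "insert c A - dom (g(c \<mapsto> k)) = A - dom g" for k
    using assms by auto
  show ?thesis
    unfolding expansion_term_def t u fibre_size_upd[OF fin c] Delta_mult Delta_ring_t_power
    by (subst Delta_prod_list_ring_y)
      (simp_all add: sum_distrib_right power_commutes mult.assoc add.commute
         del: upt_Suc sum.op_ivl_Suc fun_upd_apply)
qed

definition earlier :: "nat \<times> nat \<Rightarrow> nat set" where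
  "earlier c = {1..<fst c}"

text \<open>
  One row of cells. The row number \<open>Suc n\<close> makes \<open>earlier\<close> offer exactly the \<open>n\<close> factors present;
  the cells of the row must be fresh, so that each of them extends the partial maps on \<open>A\<close>.
\<close>

lemma op_power_expansion:
  assumes "finite A" and "A \<inter> {Suc n} \<times> UNIV = {}"
  shows "(op ^^ e) (\<Sum>g\<in>choices earlier A. expansion_term n A g)
    = (\<Sum>g\<in>choices earlier (A \<union> {Suc n} \<times> {1..e}). expansion_term n (A \<union> {Suc n} \<times> {1..e}) g)"
proof (induction e)
  case (Suc e)
  let ?B = "A \<union> {Suc n} \<times> {1..e}" and ?c = "(Suc n, Suc e)"
  have B: "finite ?B" "?c \<notin> ?B"
    using assms by auto
  have eq: "A \<union> {Suc n} \<times> {1..Suc e} = insert ?c ?B"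
    by (auto simp: le_Suc_eq)
  have "(op ^^ Suc e) (\<Sum>g\<in>choices earlier A. expansion_term n A g)
      = op (\<Sum>g\<in>choices earlier ?B. expansion_term n ?B g)"
    using Suc by simp
  also have "\<dots> = (\<Sum>g\<in>choices earlier ?B. op (expansion_term n ?B g))"
    by (simp add: Delta_sum sum_distrib_right sum.distrib)
  also have "\<dots> = (\<Sum>g\<in>choices earlier ?B. expansion_term n (insert ?c ?B) g
      + (\<Sum>k\<in>earlier ?c. expansion_term n (insert ?c ?B) (g(?c \<mapsto> k))))"
    unfolding earlier_def fst_conv
    by (rule sum.cong[OF refl], rule op_term[OF B]) (simp add: choices_def)
  also have "\<dots> = (\<Sum>g\<in>choices earlier (insert ?c ?B). expansion_term n (insert ?c ?B) g)"
    by (rule sum_choices_insert[symmetric]) (use B in \<open>simp_all add: earlier_def\<close>)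
  finally show ?case unfolding eq .
qed simp

lemma U_poly_expansion:
  "U_poly n d = (\<Sum>g\<in>choices earlier ({1..n} \<times> {1..d}). expansion_term n ({1..n} \<times> {1..d}) g)"
proof (induction n)
  case 0
  have "choices earlier {} = {Map.empty}" by (auto simp: choices_def)
  then show ?case by (simp add: expansion_term_def)
next
  case (Suc n)
  let ?A = "{1..Suc n} \<times> {1..d}"
  have A: "{1..n} \<times> {1..d} \<union> {Suc n} \<times> {1..d} = ?A"
    by (auto simp: le_Suc_eq)
  have "U_poly (Suc n) d = ring_y 0 * (\<Sum>g\<in>choices earlier ?A. expansion_term n ?A g)"
    unfolding U_poly.simps Suc A[symmetric] by (subst op_power_expansion) auto
  also have "\<dots> = (\<Sum>g\<in>choices earlier ?A. expansion_term (Suc n) ?A g)"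
    unfolding sum_distrib_left
  proof (rule sum.cong[OF refl])
    fix g assume g: "g \<in> choices earlier ?A"
    \<comment> \<open>no cell used so far may hit the factor that is being added, so its index is still 0\<close>
    have "g a \<noteq> Some (Suc n)" for a
      using g by (cases a) (force simp: choices_def earlier_def dom_def)
    then have "fibre_size g (Suc n) = 0"
      by (simp add: fibre_size_def)
    then show "ring_y 0 * expansion_term n ?A g = expansion_term (Suc n) ?A g"
      by (simp add: expansion_term_def mult.assoc)
  qed
  finally show ?case .
qed

section \<open>Comparing fibre sizes with the partition\<close>

lemma image_fibre_size:
  assumes "finite B" and "ran g \<subseteq> B"
  shows "image_mset (fibre_size g) (mset_set B) = fibre_cards g + replicate_mset (card (B - ran g)) 0"
proof -
  have "finite (ran g)"
    using assms finite_subset by blast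
  then have "mset_set B = mset_set (ran g) + mset_set (B - ran g)"
    using mset_set_Union[of "ran g" "B - ran g"] assms by (simp add: Un_absorb1)
  moreover have "image_mset (fibre_size g) (mset_set (B - ran g)) = image_mset (\<lambda>_. 0) (mset_set (B - ran g))"
    using assms by (intro image_mset_cong) (auto simp: fibre_size_def ran_def)
  ultimately show ?thesis
    by (simp add: fibre_cards_def fibre_size_def [abs_def] image_mset_const_eq)
qed

lemma zero_notin_fibre_cards:
  assumes "finite (dom g)"
  shows "0 \<notin># fibre_cards g"
proof -
  have "finite {a. g a = Some b}" for b
    using assms by (rule finite_subset[rotated]) auto
  then show ?thesis
    using finite_ran[OF assms] by (auto simp: fibre_cards_def) (auto simp: ran_def)
qed

lemma sum_fibre_cards:
  assumes "finite (dom g)"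
  shows "sum_mset (fibre_cards g) = card (dom g)"
proof -
  have fin: "finite {a. g a = Some b}" for b
    using assms by (rule finite_subset[rotated]) auto
  have "dom g = (\<Union>b\<in>ran g. {a. g a = Some b})"
    by (auto simp: ran_def dom_def)
  moreover have "card (\<Union>b\<in>ran g. {a. g a = Some b}) = (\<Sum>b\<in>ran g. card {a. g a = Some b})"
    using assms fin by (intro card_UN_disjoint) (auto simp: finite_ran)
  ultimately show ?thesis
    by (simp add: fibre_cards_def sum_unfold_sum_mset)
qed

lemma pad_zeros_eq_iff:
  fixes M N :: "nat multiset"
  assumes "0 \<notin># M" and "0 \<notin># N" and "size M + a = size N + b"
  shows "M + replicate_mset a 0 = N + replicate_mset b 0 \<longleftrightarrow> M = N"
proof
  assume eq: "M + replicate_mset a 0 = N + replicate_mset b 0"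
  show "M = N"
  proof (rule multiset_eqI)
    fix x
    have "count M x + count (replicate_mset a 0) x = count N x + count (replicate_mset b 0) x"
      using eq by (simp only: flip: count_union)
    then show "count M x = count N x"
      using assms(1,2) by (cases "x = 0") (simp_all only: not_in_iff count_replicate_mset if_False add_0_right)
  qed
next
  assume "M = N"
  moreover from this have "a = b"
    using assms(3) by (simp only: add_left_cancel)
  ultimately show "M + replicate_mset a 0 = N + replicate_mset b 0"
    by (simp only:)
qed

text \<open>
  The exponents of \<open>t\<close> need no separate comparison: the fibre sizes add up to the number of cells
  where \<open>g\<close> is defined, so once they match \<open>lam\<close> the number of remaining cells is right as well.
  The zeros match because both sides have \<open>n\<close> indices in total.
\<close>

lemma term_word_eq_monom_word_iff:
  assumes "finite A" and "dom g \<subseteq> A" and "ran g \<subseteq> {1..n}"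
    and "0 \<notin> set lam" and "length lam \<le> n"
  shows "abs_yt_word (map Y (map (fibre_size g) (rev [1..<Suc n])) @ replicate (card (A - dom g)) T)
      = monom_word (n - length lam) lam (card A - sum_list lam) \<longleftrightarrow> fibre_cards g = mset lam"
proof -
  have fin: "finite (dom g)" "finite (ran g)"
    using assms finite_subset by blast+
  have monom: "monom_word (n - length lam) lam k
      = abs_yt_word (map Y (replicate (n - length lam) 0 @ lam) @ replicate k T)" for k
    by (simp add: monom_word_def)
  have "mset (rev [1..<Suc n]) = mset_set {1..n}"
    by (metis mset_rev mset_upt atLeastLessThanSuc_atLeastAtMost)
  then have fibres: "mset (map (fibre_size g) (rev [1..<Suc n])) = fibre_cards g + replicate_mset (card ({1..n} - ran g)) 0"
    using image_fibre_size[of "{1..n}" g] assms(3) by (simp del: upt_Suc)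
  have "card (ran g) \<le> n"
    using card_mono[of "{1..n}" "ran g"] assms(3) by simp
  then have sz: "size (fibre_cards g) + card ({1..n} - ran g) = size (mset lam) + (n - length lam)"
    using assms(3,5) fin by (simp add: fibre_cards_def card_Diff_subset)
  have "mset (map (fibre_size g) (rev [1..<Suc n])) = mset (replicate (n - length lam) 0 @ lam)
      \<longleftrightarrow> fibre_cards g = mset lam"
    using pad_zeros_eq_iff[OF zero_notin_fibre_cards[OF fin(1)] _ sz] assms(4)
    unfolding fibres by (simp add: add.commute)
  moreover have "card (A - dom g) = card A - sum_list lam" if "fibre_cards g = mset lam"
    using sum_fibre_cards[OF fin(1)] that assms(2) fin by (simp add: card_Diff_subset sum_mset_sum_list)
  ultimately show ?thesis
    unfolding monom abs_normal_word_eq_iff by blast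
qed

theorem proposition6p10:
  fixes n d :: nat and lam :: "nat list"
  assumes "n \<ge> 1" and "d \<ge> 1"
    and "is_partition lam"
    and "sum_list lam \<le> (n - 1) * d"
    and "length lam \<le> n - 1"
  shows "coeff_c n d lam = int (card {g \<in> partial_maps ({1..n} \<times> {1..d}) {1..n}.
           (\<forall>i j k. g (i, j) = Some k \<longrightarrow> k < i) \<and> fibre_cards g = mset lam})"
proof -
  let ?A = "{1..n} \<times> {1..d}"
  let ?G = "choices earlier ?A"
  let ?w = "\<lambda>g. abs_yt_word (map Y (map (fibre_size g) (rev [1..<Suc n])) @ replicate (card (?A - dom g)) T)"
  let ?m = "monom_word (n - length lam) lam (n * d - sum_list lam)"
  have fin: "finite ?G"
    by (rule finite_choices) (auto simp: earlier_def)
  have ran: "ran g \<subseteq> {1..n}" if "g \<in> ?G" for g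
    using that by (force simp: choices_def earlier_def ran_def dom_def)
  have iff: "?w g = ?m \<longleftrightarrow> fibre_cards g = mset lam" if "g \<in> ?G" for g
    using term_word_eq_monom_word_iff[of ?A g n lam] ran[OF that] that assms
    by (auto simp: choices_def is_partition_def)
  have "U_poly n d = (\<Sum>g\<in>?G. Poly_Mapping.single (?w g) 1)"
    unfolding U_poly_expansion single_normal_word expansion_term_def by (simp add: comp_def del: upt_Suc)
  then have "coeff_c n d lam = (\<Sum>g\<in>?G. if ?w g = ?m then 1 else 0)"
    unfolding coeff_c_def by (simp only: lookup_sum lookup_single when_def)
  also have "\<dots> = (\<Sum>g\<in>?G. if fibre_cards g = mset lam then 1 else 0)"
    by (rule sum.cong[OF refl]) (simp only: iff)
  also have "\<dots> = int (card {g \<in> ?G. fibre_cards g = mset lam})"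
    using fin by (simp add: sum.If_cases Int_def)
  also have "{g \<in> ?G. fibre_cards g = mset lam} = {g \<in> partial_maps ?A {1..n}.
      (\<forall>i j k. g (i, j) = Some k \<longrightarrow> k < i) \<and> fibre_cards g = mset lam}"
  proof -
    have "g \<in> ?G \<longleftrightarrow> g \<in> partial_maps ?A {1..n} \<and> (\<forall>i j k. g (i, j) = Some k \<longrightarrow> k < i)" for g
    proof
      assume "g \<in> ?G"
      then show "g \<in> partial_maps ?A {1..n} \<and> (\<forall>i j k. g (i, j) = Some k \<longrightarrow> k < i)"
        using ran[of g] by (force simp: partial_maps_def choices_def earlier_def)
    next
      assume "g \<in> partial_maps ?A {1..n} \<and> (\<forall>i j k. g (i, j) = Some k \<longrightarrow> k < i)"
      then show "g \<in> ?G"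
        by (force simp: partial_maps_def choices_def earlier_def ran_def)
    qed
    then show ?thesis by blast
  qed
  finally show ?thesis .
qed

end
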